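(* Let $R$ be a commutative ring with identity, $M$ an $R$-module, $S(M)$ the set of all submodules of $M$, and $\psi: S(M) \to S(M)\cup\{\emptyset\}$ a function. Let $N$ be a $\psi$-second submodule of $M$ such that $Ann_R(N)\,\psi(N) \not\subseteq N$. Then $N$ is a second submodule of $M$.
   Context: For a function $\psi: S(M)\to S(M)\cup\{\emptyset\}$, a non-zero submodule $N$ of $M$ is called a $\psi$-second submodule of $M$ if for all $r\in R$ and all submodules $K$ of $M$ with $rN\subseteq K$ and $r\psi(N)\not\subseteq K$, one has $N\subseteq K$ or $rN=0$. Products with $\emptyset$ are read elementwise, so $r\emptyset=\emptyset$. A non-zero submodule $N$ of $M$ is called second if for each $a\in R$ the multiplication map $N\xrightarrow{a}N$ is either surjective or zero (i.e. $aN=N$ or $aN=0$). $Ann_R(N)=\{r\in R: rN=0\}$. *)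

theory Defs
  imports "HOL-Algebra.Module"
begin

definition submodules :: "('a, 'c) ring_scheme \<Rightarrow> ('a, 'b, 'd) module_scheme \<Rightarrow> 'b set set"
  where "submodules R M = {N. submodule N R M}"

definition smult_set :: "('a, 'b, 'd) module_scheme \<Rightarrow> 'a \<Rightarrow> 'b set \<Rightarrow> 'b set"
  where "smult_set M r X = (\<lambda>x. r \<odot>\<^bsub>M\<^esub> x) ` X"

definition annihilator ::
    "('a, 'c) ring_scheme \<Rightarrow> ('a, 'b, 'd) module_scheme \<Rightarrow> 'b set \<Rightarrow> 'a set"
  where "annihilator R M N = {r \<in> carrier R. smult_set M r N = {\<zero>\<^bsub>M\<^esub>}}"

text \<open>
  The finite sums of products, with at least one summand: for a submodule \<open>X\<close> this is the
  usual submodule \<open>I X\<close> (as in HOL-Algebra's product of ideals), and for \<open>X = \<emptyset>\<close> it is \<open>\<emptyset>\<close>.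
\<close>
inductive_set ideal_smult :: "('a, 'b, 'd) module_scheme \<Rightarrow> 'a set \<Rightarrow> 'b set \<Rightarrow> 'b set"
  for M and I and X where
    smult: "\<lbrakk> r \<in> I; x \<in> X \<rbrakk> \<Longrightarrow> r \<odot>\<^bsub>M\<^esub> x \<in> ideal_smult M I X"
  | sum: "\<lbrakk> s \<in> ideal_smult M I X; t \<in> ideal_smult M I X \<rbrakk> \<Longrightarrow> s \<oplus>\<^bsub>M\<^esub> t \<in> ideal_smult M I X"

definition psi_second ::
    "('a, 'c) ring_scheme \<Rightarrow> ('a, 'b, 'd) module_scheme \<Rightarrow> ('b set \<Rightarrow> 'b set) \<Rightarrow> 'b set \<Rightarrow> bool"
  where "psi_second R M \<psi> N \<longleftrightarrow>
    submodule N R M \<and> N \<noteq> {\<zero>\<^bsub>M\<^esub>} \<and>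
    (\<forall>r \<in> carrier R. \<forall>K \<in> submodules R M.
      smult_set M r N \<subseteq> K \<and> \<not> smult_set M r (\<psi> N) \<subseteq> K \<longrightarrow>
        N \<subseteq> K \<or> smult_set M r N = {\<zero>\<^bsub>M\<^esub>})"

definition second_submodule ::
    "('a, 'c) ring_scheme \<Rightarrow> ('a, 'b, 'd) module_scheme \<Rightarrow> 'b set \<Rightarrow> bool"
  where "second_submodule R M N \<longleftrightarrow>
    submodule N R M \<and> N \<noteq> {\<zero>\<^bsub>M\<^esub>} \<and>
    (\<forall>a \<in> carrier R. smult_set M a N = N \<or> smult_set M a N = {\<zero>\<^bsub>M\<^esub>})"

end

theory Submission
  imports Defs
begin

text \<open>
  Some $b \in Ann_R(N)$ has $b\,\psi(N) \not\subseteq N$. Replacing $a$ by $a + b$ does not change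
  the action on $N$, but if $a\,\psi(N) \subseteq aN$ then $(a+b)\,\psi(N) \not\subseteq aN$. So the
  $\psi$-second condition with $K = aN$ applies to $a$ or to $a + b$.
\<close>

text \<open>The set \<open>a N\<close> is the image of \<open>N\<close> under multiplication by
  \<open>a\<close>. Commutativity of \<open>R\<close> makes this map linear, since r(an) = a(rn), so
  the image is a submodule and may serve as \<open>K\<close> in the \<psi>-second condition.\<close>

lemma submodule_smult_set:
  assumes "module R M" and "submodule N R M" and a: "a \<in> carrier R"
  shows "submodule (smult_set M a N) R M"
proof -
  interpret module R M by fact
  interpret N: submodule N R M by fact
  have NM: "N \<subseteq> carrier M"
    using N.subset by simp
  show ?thesis
  proof (rule submoduleI)
    show "smult_set M a N \<subseteq> carrier M"
      using NM a by (auto simp: smult_set_def)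
    \<comment> \<open>\<open>N\<close> is a subgroup of the additive group of \<open>M\<close>, so
      \<open>N.one_closed\<close> speaks of zero, and \<open>N.m_closed\<close> and
      \<open>N.m_inv_closed\<close> speak of sums and negatives.\<close>
    show "\<zero>\<^bsub>M\<^esub> \<in> smult_set M a N"
      using N.one_closed a unfolding smult_set_def by (auto intro!: image_eqI[where x = "\<zero>\<^bsub>M\<^esub>"])
    show "\<ominus>\<^bsub>M\<^esub> x \<in> smult_set M a N" if "x \<in> smult_set M a N" for x
    proof -
      obtain n where n: "n \<in> N" "x = a \<odot>\<^bsub>M\<^esub> n"
        using \<open>x \<in> smult_set M a N\<close> by (auto simp: smult_set_def)
      have "\<ominus>\<^bsub>M\<^esub> n \<in> N"
        using N.m_inv_closed[OF n(1)] by (simp add: a_inv_def)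
      moreover have "\<ominus>\<^bsub>M\<^esub> x = a \<odot>\<^bsub>M\<^esub> (\<ominus>\<^bsub>M\<^esub> n)"
        using n NM a smult_r_minus by auto
      ultimately show ?thesis by (auto simp: smult_set_def)
    qed
    show "x \<oplus>\<^bsub>M\<^esub> y \<in> smult_set M a N"
      if xy: "x \<in> smult_set M a N" "y \<in> smult_set M a N" for x y
    proof -
      obtain m n where mn: "m \<in> N" "x = a \<odot>\<^bsub>M\<^esub> m" "n \<in> N" "y = a \<odot>\<^bsub>M\<^esub> n"
        using xy by (auto simp: smult_set_def)
      have "m \<oplus>\<^bsub>M\<^esub> n \<in> N"
        using N.m_closed mn by simp
      moreover have "x \<oplus>\<^bsub>M\<^esub> y = a \<odot>\<^bsub>M\<^esub> (m \<oplus>\<^bsub>M\<^esub> n)"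
        using mn NM smult_r_distr[OF a, of m n] by (simp add: subset_iff)
      ultimately show ?thesis by (auto simp: smult_set_def)
    qed
    show "r \<odot>\<^bsub>M\<^esub> x \<in> smult_set M a N" if r: "r \<in> carrier R" and "x \<in> smult_set M a N" for r x
    proof -
      obtain n where n: "n \<in> N" "x = a \<odot>\<^bsub>M\<^esub> n"
        using \<open>x \<in> smult_set M a N\<close> by (auto simp: smult_set_def)
      have nM: "n \<in> carrier M"
        using n NM by auto
      have "r \<odot>\<^bsub>M\<^esub> x = (r \<otimes>\<^bsub>R\<^esub> a) \<odot>\<^bsub>M\<^esub> n"
        unfolding n(2) by (rule smult_assoc1[OF r a nM, symmetric])
      also have "\<dots> = (a \<otimes>\<^bsub>R\<^esub> r) \<odot>\<^bsub>M\<^esub> n"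
        unfolding R.m_comm[OF r a] ..
      also have "\<dots> = a \<odot>\<^bsub>M\<^esub> (r \<odot>\<^bsub>M\<^esub> n)"
        by (rule smult_assoc1[OF a r nM])
      finally have "r \<odot>\<^bsub>M\<^esub> x = a \<odot>\<^bsub>M\<^esub> (r \<odot>\<^bsub>M\<^esub> n)" .
      then show ?thesis
        using N.smult_closed[OF r n(1)] by (auto simp: smult_set_def)
    qed
  qed
qed

text \<open>\<open>N\<close> is closed under addition, so finite sums of products stay in
  \<open>N\<close> once the single products do. Read contrapositively, this extracts one product
  outside \<open>N\<close> from a non-inclusion.\<close>

lemma ideal_smult_subset:
  assumes "submodule N R M" and "\<And>r x. r \<in> I \<Longrightarrow> x \<in> X \<Longrightarrow> r \<odot>\<^bsub>M\<^esub> x \<in> N"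
  shows "ideal_smult M I X \<subseteq> N"
proof
  interpret N: submodule N R M by fact
  fix x assume "x \<in> ideal_smult M I X"
  then show "x \<in> N"
    using assms(2) N.m_closed by induction auto
qed

theorem theorem2p3:
  fixes R :: "('a, 'c) ring_scheme" and M :: "('a, 'b, 'd) module_scheme"
    and \<psi> :: "'b set \<Rightarrow> 'b set" and N :: "'b set"
  assumes "module R M"
    and "\<psi> \<in> submodules R M \<rightarrow> submodules R M \<union> {{}}"
    and "psi_second R M \<psi> N"
    and "\<not> ideal_smult M (annihilator R M N) (\<psi> N) \<subseteq> N"
  shows "second_submodule R M N"
proof -
  interpret module R M by fact
  have N: "submodule N R M" and N0: "N \<noteq> {\<zero>\<^bsub>M\<^esub>}"
    using assms(3) by (auto simp: psi_second_def)
  have second: "N \<subseteq> K \<or> smult_set M r N = {\<zero>\<^bsub>M\<^esub>}"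
      if "r \<in> carrier R" "submodule K R M" "smult_set M r N \<subseteq> K"
        "\<not> smult_set M r (\<psi> N) \<subseteq> K" for r K
    using assms(3) that by (auto simp: psi_second_def submodules_def)
  interpret N: submodule N R M by fact
  have NM: "N \<subseteq> carrier M"
    using N.subset by simp
  \<comment> \<open>Whether \<psi>(N) is a submodule or empty, its elements lie in \<open>M\<close>.
    The module laws can then be applied to the witness \<open>x\<close> chosen below.\<close>
  have psiM: "\<psi> N \<subseteq> carrier M"
  proof -
    have "\<psi> N \<in> submodules R M \<union> {{}}"
      using assms(2) N by (auto simp: submodules_def)
    then show ?thesis
      using submoduleE(1) by (auto simp: submodules_def)
  qed
  obtain b x where b: "b \<in> annihilator R M N" and x: "x \<in> \<psi> N" and bx: "b \<odot>\<^bsub>M\<^esub> x \<notin> N"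
    using assms(4) ideal_smult_subset[OF N] by blast
  have bN: "b \<odot>\<^bsub>M\<^esub> n = \<zero>\<^bsub>M\<^esub>" if "n \<in> N" for n
    using b that by (auto simp: annihilator_def smult_set_def)
  have bR: "b \<in> carrier R"
    using b by (simp add: annihilator_def)
  have xM: "x \<in> carrier M"
    using x psiM by auto
  have "smult_set M a N = N \<or> smult_set M a N = {\<zero>\<^bsub>M\<^esub>}" if a: "a \<in> carrier R" for a
  proof -
    have K: "submodule (smult_set M a N) R M"
      using assms(1) N a by (rule submodule_smult_set)
    \<comment> \<open>This leaves only the inclusion of N in aN to prove, and it lets non-membership
      in N pass to non-membership in aN.\<close>
    have KN: "smult_set M a N \<subseteq> N"
      using a N.smult_closed by (auto simp: smult_set_def)
    have "N \<subseteq> smult_set M a N \<or> smult_set M a N = {\<zero>\<^bsub>M\<^esub>}"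
    proof (cases "smult_set M a (\<psi> N) \<subseteq> smult_set M a N")
      \<comment> \<open>The \<psi>-second condition applies to \<open>a\<close> itself with K = aN,
        as aN \<subseteq> K is trivial.\<close>
      case False
      then show ?thesis
        using second[OF a K] by simp
    next
      case True
      have "(a \<oplus>\<^bsub>R\<^esub> b) \<odot>\<^bsub>M\<^esub> n = a \<odot>\<^bsub>M\<^esub> n" if "n \<in> N" for n
      proof -
        have "n \<in> carrier M"
          using that NM by auto
        then show ?thesis
          using a bR bN[OF that] by (simp add: smult_l_distr)
      qed
      then have eq: "smult_set M (a \<oplus>\<^bsub>R\<^esub> b) N = smult_set M a N"
        by (simp add: smult_set_def)
      have axN: "a \<odot>\<^bsub>M\<^esub> x \<in> N"
        using True KN x by (auto simp: smult_set_def)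
      \<comment> \<open>Otherwise subtracting ax, which lies in N, would put bx in N, against the
        choice of \<open>b\<close> and \<open>x\<close>.\<close>
      have "(a \<oplus>\<^bsub>R\<^esub> b) \<odot>\<^bsub>M\<^esub> x \<notin> N"
      proof
        assume "(a \<oplus>\<^bsub>R\<^esub> b) \<odot>\<^bsub>M\<^esub> x \<in> N"
        then have "\<ominus>\<^bsub>M\<^esub> (a \<odot>\<^bsub>M\<^esub> x) \<oplus>\<^bsub>M\<^esub> (a \<oplus>\<^bsub>R\<^esub> b) \<odot>\<^bsub>M\<^esub> x \<in> N"
          using axN N.m_closed N.m_inv_closed[OF axN] by (simp add: a_inv_def)
        moreover have "\<ominus>\<^bsub>M\<^esub> (a \<odot>\<^bsub>M\<^esub> x) \<oplus>\<^bsub>M\<^esub> (a \<oplus>\<^bsub>R\<^esub> b) \<odot>\<^bsub>M\<^esub> x = b \<odot>\<^bsub>M\<^esub> x"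
          using a bR xM by (simp add: smult_l_distr M.r_neg1)
        ultimately show False
          using bx by simp
      qed
      moreover have "(a \<oplus>\<^bsub>R\<^esub> b) \<odot>\<^bsub>M\<^esub> x \<in> smult_set M (a \<oplus>\<^bsub>R\<^esub> b) (\<psi> N)"
        using x by (simp add: smult_set_def)
      ultimately have "\<not> smult_set M (a \<oplus>\<^bsub>R\<^esub> b) (\<psi> N) \<subseteq> smult_set M a N"
        using KN by blast
      moreover have "a \<oplus>\<^bsub>R\<^esub> b \<in> carrier R"
        using a bR by simp
      \<comment> \<open>By \<open>eq\<close>, both the premise (a+b)N \<subseteq> aN and the
        alternative (a+b)N = 0 turn into statements about aN.\<close>
      ultimately show ?thesis
        using second[of "a \<oplus>\<^bsub>R\<^esub> b", OF _ K] unfolding eq by blast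
    qed
    then show ?thesis
      using KN by auto
  qed
  then show ?thesis
    using N N0 by (simp add: second_submodule_def)
qed

end
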